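(* Let $F,G\in\mathcal R$, $\mathbf a\in\mathbb F^n$, $\lambda\in\mathbb F$ and $m\in\mathcal M$. Then: 1) $\Delta^m_{\mathbf a}\lambda=0$ if $m\ne o$, and $\Delta^m_{\mathbf a}(\lambda F+G)=\lambda\,(\Delta^m_{\mathbf a}F)+\Delta^m_{\mathbf a}G$; 2) if $\varphi$ is an isomorphism of additive groups, then $\Delta^m_{\mathbf a,L}\lambda=0$ if $m\neq o$, and $\Delta^m_{\mathbf a,L}(F\lambda+G)=(\Delta^m_{\mathbf a,L}F)\,\lambda+\Delta^m_{\mathbf a,L}G$.
   Context: $\mathbb F$ is a division ring, $n\ge1$, $\sigma=(\sigma_{i,j}):\mathbb F\to\mathbb F^{n\times n}$ is a (unital) ring homomorphism and $\delta={}^t(\delta_1,\dots,\delta_n):\mathbb F\to\mathbb F^{n\times1}$ is a $\sigma$-vector derivation, i.e. additive with $\delta(ab)=\sigma(a)\delta(b)+\delta(a)b$. $\mathcal M$ is the free monoid on $x_1,\dots,x_n$, with empty word $o$ (identified with $1$). $\mathcal R=\mathbb F[\mathbf x;\sigma,\delta]$ is the free left $\mathbb F$-module with basis $\mathcal M$, with the ring multiplication that concatenates monomials and satisfies $x_i a=\sum_j\sigma_{i,j}(a)x_j+\delta_i(a)$ for $a\in\mathbb F$. Define $\varphi:\mathbb F^n\to\mathbb F^n$ by $\varphi(\gamma_1,\dots,\gamma_n)=\big(\sum_j\sigma_{j,1}(\gamma_j),\dots,\sum_j\sigma_{j,n}(\gamma_j)\big)$. For $\mathbf a=(a_1,\dots,a_n)\in\mathbb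 F^n$ every $F\in\mathcal R$ is uniquely $F=\sum_i(\Delta_{\mathbf a}^{x_i}F)\,(x_i-a_i)+F(\mathbf a)$ with $\Delta_{\mathbf a}^{x_i}F\in\mathcal R$, $F(\mathbf a)\in\mathbb F$. When $\varphi$ is bijective, every $F$ is uniquely $F=\sum_i(x_i-a_i)\,(\Delta_{\mathbf a,L}^{x_i}F)+F_L(\mathbf a)$ with $\Delta_{\mathbf a,L}^{x_i}F\in\mathcal R$, $F_L(\mathbf a)\in\mathbb F$. For $m=x_{i_1}\cdots x_{i_s}$: $\Delta_{\mathbf a}^mF=\Delta_{\mathbf a}^{x_{i_1}}(\Delta_{\mathbf a}^{x_{i_2}}(\cdots\Delta_{\mathbf a}^{x_{i_s}}F))$ and $\Delta_{\mathbf a,L}^mF=\Delta_{\mathbf a,L}^{x_{i_s}}(\Delta_{\mathbf a,L}^{x_{i_{s-1}}}(\cdots\Delta_{\mathbf a,L}^{x_{i_1}}F))$; $\Delta^o_{\mathbf a}F=\Delta^o_{\mathbf a,L}F=F$. *)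

theory Defs
  imports "HOL-Analysis.Analysis" "HOL-Library.Poly_Mapping"
begin

definition matrix_ring_hom :: "('a::division_ring \<Rightarrow> 'a^'n^'n) \<Rightarrow> bool" where
  "matrix_ring_hom \<sigma> \<longleftrightarrow>
     (\<forall>a b. \<sigma> (a + b) = \<sigma> a + \<sigma> b) \<and>
     (\<forall>a b. \<sigma> (a * b) = \<sigma> a ** \<sigma> b) \<and>
     \<sigma> 1 = mat 1"

definition vector_derivation :: "('a::division_ring \<Rightarrow> 'a^'n^'n) \<Rightarrow> ('a \<Rightarrow> 'a^'n) \<Rightarrow> bool" where
  "vector_derivation \<sigma> \<delta> \<longleftrightarrow>
     (\<forall>a b. \<delta> (a + b) = \<delta> a + \<delta> b) \<and>
     (\<forall>a b. \<delta> (a * b) = \<sigma> a *v \<delta> b + (\<chi> i. \<delta> a $ i * b))"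

definition phi :: "('a::division_ring \<Rightarrow> 'a^'n^'n) \<Rightarrow> 'a^'n \<Rightarrow> 'a^'n" where
  "phi \<sigma> g = (\<chi> k. \<Sum>j\<in>UNIV. \<sigma> (g $ j) $ j $ k)"

text \<open>
  The variables are indexed by the finite type \<open>'n\<close>, the free monoid on them is \<open>'n list\<close> with
  concatenation, and the free left module on the monoid is \<open>'n list \<Rightarrow>\<^sub>0 'a\<close>. (The theory
  \<^theory>\<open>HOL-Library.Poly_Mapping\<close> puts a product on \<open>'m \<Rightarrow>\<^sub>0 'a\<close> only for additive monoids \<open>'m\<close>;
  lists are not an instance, so there is no competing product.)
\<close>

type_synonym ('a, 'n) skew_poly = "'n list \<Rightarrow>\<^sub>0 'a"

abbreviation const :: "'a::division_ring \<Rightarrow> ('a, 'n) skew_poly" where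
  "const c \<equiv> Poly_Mapping.single [] c"

abbreviation var :: "'n \<Rightarrow> ('a::division_ring, 'n) skew_poly" where
  "var i \<equiv> Poly_Mapping.single [i] 1"

definition scale :: "'a::division_ring \<Rightarrow> ('a, 'n) skew_poly \<Rightarrow> ('a, 'n) skew_poly" where
  "scale c F = Poly_Mapping.map (\<lambda>b. c * b) F"

text \<open>
  Left multiplication by a variable is forced by the commutation rule:
  \<open>x\<^sub>i (c m) = (\<Sum>\<^sub>j \<sigma>\<^sub>i\<^sub>j(c) x\<^sub>j + \<delta>\<^sub>i(c)) m\<close>. The product of two skew polynomials is then forced by
  associativity and left linearity; that it is a ring multiplication with the required
  properties is proved below.
\<close>

definition var_times ::
    "('a::division_ring \<Rightarrow> 'a^'n^'n) \<Rightarrow> ('a \<Rightarrow> 'a^'n) \<Rightarrow> 'n::finite \<Rightarrow>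
     ('a, 'n) skew_poly \<Rightarrow> ('a, 'n) skew_poly" where
  "var_times \<sigma> \<delta> i F =
     (\<Sum>m\<in>Poly_Mapping.keys F.
        (\<Sum>j\<in>UNIV. Poly_Mapping.single (j # m) (\<sigma> (Poly_Mapping.lookup F m) $ i $ j)) +
        Poly_Mapping.single m (\<delta> (Poly_Mapping.lookup F m) $ i))"

definition word_times ::
    "('a::division_ring \<Rightarrow> 'a^'n^'n) \<Rightarrow> ('a \<Rightarrow> 'a^'n) \<Rightarrow> ('n::finite) list \<Rightarrow>
     ('a, 'n) skew_poly \<Rightarrow> ('a, 'n) skew_poly" where
  "word_times \<sigma> \<delta> m F = foldr (var_times \<sigma> \<delta>) m F"

definition skew_mult ::
    "('a::division_ring \<Rightarrow> 'a^'n^'n) \<Rightarrow> ('a \<Rightarrow> 'a^'n) \<Rightarrow>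
     ('a, 'n::finite) skew_poly \<Rightarrow> ('a, 'n) skew_poly \<Rightarrow> ('a, 'n) skew_poly" where
  "skew_mult \<sigma> \<delta> F G =
     (\<Sum>m\<in>Poly_Mapping.keys F. scale (Poly_Mapping.lookup F m) (word_times \<sigma> \<delta> m G))"

lemma lookup_scale: "Poly_Mapping.lookup (scale c F) m = c * Poly_Mapping.lookup F m"
  by (simp add: scale_def map.rep_eq when_def)

lemma scale_add: "scale c (F + G) = scale c F + scale c G"
  by (rule poly_mapping_eqI) (simp add: lookup_scale lookup_add distrib_left)

lemma scale_add_left: "scale (c + d) F = scale c F + scale d F"
  by (rule poly_mapping_eqI) (simp add: lookup_scale lookup_add distrib_right)

lemma scale_zero [simp]: "scale c 0 = 0"
  by (rule poly_mapping_eqI) (simp add: lookup_scale)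

lemma scale_zero_left [simp]: "scale 0 F = 0"
  by (rule poly_mapping_eqI) (simp add: lookup_scale)

lemma scale_one [simp]: "scale 1 F = F"
  by (rule poly_mapping_eqI) (simp add: lookup_scale)

lemma scale_scale: "scale c (scale d F) = scale (c * d) F"
  by (rule poly_mapping_eqI) (simp add: lookup_scale mult.assoc)

lemma scale_single: "scale c (Poly_Mapping.single m d) = Poly_Mapping.single m (c * d)"
  by (rule poly_mapping_eqI) (simp add: lookup_scale lookup_single when_def)

lemma scale_sum: "scale c (sum f A) = (\<Sum>x\<in>A. scale c (f x))"
  by (induction A rule: infinite_finite_induct) (auto simp: scale_add)

lemma scale_sum_left: "scale (sum f A) F = (\<Sum>x\<in>A. scale (f x) F)"
  by (induction A rule: infinite_finite_induct) (auto simp: scale_add_left)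

lemma single_sum: "Poly_Mapping.single m (sum f A) = (\<Sum>x\<in>A. Poly_Mapping.single m (f x))"
  by (induction A rule: infinite_finite_induct) (auto simp: single_add)

lemma keys_sum_add:
  fixes f :: "'m \<Rightarrow> 'a::ab_group_add \<Rightarrow> 'b::ab_group_add"
  assumes "\<And>m x y. f m (x + y) = f m x + f m y"
  shows "(\<Sum>m\<in>Poly_Mapping.keys (F + G). f m (Poly_Mapping.lookup (F + G) m)) =
         (\<Sum>m\<in>Poly_Mapping.keys F. f m (Poly_Mapping.lookup F m)) +
         (\<Sum>m\<in>Poly_Mapping.keys G. f m (Poly_Mapping.lookup G m))"
proof -
  have f0: "f m 0 = 0" for m
    using assms[of m 0 0] by simp
  show ?thesis
    by (rule setsum_keys_plus_distrib) (simp_all add: f0 assms)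
qed

lemma skew_poly_induct [case_names zero single add]:
  fixes F :: "('a::division_ring, 'n) skew_poly"
  assumes "P 0" "\<And>m c. P (Poly_Mapping.single m c)" "\<And>F G. P F \<Longrightarrow> P G \<Longrightarrow> P (F + G)"
  shows "P F"
proof -
  have "P (\<Sum>m\<in>A. Poly_Mapping.single m (Poly_Mapping.lookup F m))" for A
    by (induction A rule: infinite_finite_induct) (auto intro: assms)
  moreover have "F = (\<Sum>m\<in>Poly_Mapping.keys F. Poly_Mapping.single m (Poly_Mapping.lookup F m))"
    by (rule poly_mapping_eqI) (auto simp: lookup_sum lookup_single when_def in_keys_iff)
  ultimately show ?thesis
    by metis
qed

context
  fixes \<sigma> :: "'a::division_ring \<Rightarrow> 'a^'n::finite^'n" and \<delta> :: "'a \<Rightarrow> 'a^'n"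
  assumes \<sigma>: "matrix_ring_hom \<sigma>" and \<delta>: "vector_derivation \<sigma> \<delta>"
begin

lemma sigma_simps:
  "\<sigma> (a + b) = \<sigma> a + \<sigma> b" "\<sigma> 0 = 0" "\<sigma> 1 = mat 1"
  "\<sigma> (a * b) $ i $ k = (\<Sum>j\<in>UNIV. \<sigma> a $ i $ j * \<sigma> b $ j $ k)"
  using \<sigma> unfolding matrix_ring_hom_def
  by (auto simp: matrix_matrix_mult_def) (metis add_cancel_right_right add_0)

lemma delta_simps:
  "\<delta> (a + b) = \<delta> a + \<delta> b" "\<delta> 0 = 0" "\<delta> 1 = 0"
  "\<delta> (a * b) $ i = (\<Sum>j\<in>UNIV. \<sigma> a $ i $ j * \<delta> b $ j) + \<delta> a $ i * b"
proof -
  show add: "\<delta> (a + b) = \<delta> a + \<delta> b" for a b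
    using \<delta> unfolding vector_derivation_def by blast
  show "\<delta> 0 = 0"
    using add[of 0 0] by simp
  have mult: "\<delta> (a * b) = \<sigma> a *v \<delta> b + (\<chi> i. \<delta> a $ i * b)" for a b
    using \<delta> unfolding vector_derivation_def by blast
  show "\<delta> (a * b) $ i = (\<Sum>j\<in>UNIV. \<sigma> a $ i $ j * \<delta> b $ j) + \<delta> a $ i * b"
    by (simp add: mult matrix_vector_mult_def)
  show "\<delta> 1 = 0"
    using mult[of 1 1] by (simp add: sigma_simps)
qed

lemma var_times_single:
  "var_times \<sigma> \<delta> i (Poly_Mapping.single m c) =
     (\<Sum>j\<in>UNIV. Poly_Mapping.single (j # m) (\<sigma> c $ i $ j)) + Poly_Mapping.single m (\<delta> c $ i)"
  by (cases "c = 0") (simp_all add: var_times_def sigma_simps delta_simps)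

lemma var_times_add: "var_times \<sigma> \<delta> i (F + G) = var_times \<sigma> \<delta> i F + var_times \<sigma> \<delta> i G"
  unfolding var_times_def
  by (rule keys_sum_add)
     (simp add: sigma_simps delta_simps single_add sum.distrib algebra_simps)

lemma var_times_zero [simp]: "var_times \<sigma> \<delta> i 0 = 0"
  by (simp add: var_times_def)

lemma var_times_scale:
  "var_times \<sigma> \<delta> i (scale c F) =
     (\<Sum>j\<in>UNIV. scale (\<sigma> c $ i $ j) (var_times \<sigma> \<delta> j F)) + scale (\<delta> c $ i) F"
proof (induction F rule: skew_poly_induct)
  case (single m d)
  have "(\<Sum>k\<in>UNIV. Poly_Mapping.single (k # m) (\<Sum>j\<in>UNIV. \<sigma> c $ i $ j * \<sigma> d $ j $ k)) =
        (\<Sum>j\<in>UNIV. \<Sum>k\<in>UNIV. Poly_Mapping.single (k # m) (\<sigma> c $ i $ j * \<sigma> d $ j $ k))"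
    by (subst sum.swap) (simp add: single_sum)
  thus ?case
    by (simp add: scale_single var_times_single sigma_simps delta_simps scale_add scale_sum
        sum.distrib single_add single_sum add.assoc)
qed (simp_all add: scale_add var_times_add sum.distrib add_ac)

lemma word_times_simps [simp]:
  "word_times \<sigma> \<delta> [] F = F"
  "word_times \<sigma> \<delta> (i # m) F = var_times \<sigma> \<delta> i (word_times \<sigma> \<delta> m F)"
  by (simp_all add: word_times_def)

lemma word_times_zero [simp]: "word_times \<sigma> \<delta> m 0 = 0"
  by (induction m) simp_all

lemma word_times_add: "word_times \<sigma> \<delta> m (F + G) = word_times \<sigma> \<delta> m F + word_times \<sigma> \<delta> m G"
  by (induction m) (simp_all add: var_times_add)

lemma word_times_word: "word_times \<sigma> \<delta> m (Poly_Mapping.single m' 1) = Poly_Mapping.single (m @ m') 1"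
proof (induction m)
  case (Cons i m)
  have "(\<Sum>j\<in>UNIV. Poly_Mapping.single (j # m @ m') (mat 1 $ i $ j :: 'a)) =
        (\<Sum>j\<in>UNIV. if i = j then Poly_Mapping.single (j # m @ m') 1 else 0)"
    by (intro sum.cong) (auto simp: mat_def)
  thus ?case
    by (simp add: Cons var_times_single sigma_simps delta_simps)
qed simp

lemma skew_mult_single:
  "skew_mult \<sigma> \<delta> (Poly_Mapping.single m c) G = scale c (word_times \<sigma> \<delta> m G)"
  by (cases "c = 0") (simp_all add: skew_mult_def)

lemma skew_mult_zero [simp]: "skew_mult \<sigma> \<delta> 0 G = 0"
  by (simp add: skew_mult_def)

lemma skew_mult_add_left:
  "skew_mult \<sigma> \<delta> (F + G) H = skew_mult \<sigma> \<delta> F H + skew_mult \<sigma> \<delta> G H"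
  unfolding skew_mult_def by (rule keys_sum_add) (simp add: scale_add_left)

lemma skew_mult_sum_left:
  "skew_mult \<sigma> \<delta> (sum f A) H = (\<Sum>x\<in>A. skew_mult \<sigma> \<delta> (f x) H)"
  by (induction A rule: infinite_finite_induct) (simp_all add: skew_mult_add_left)

lemma skew_mult_add_right:
  "skew_mult \<sigma> \<delta> F (G + H) = skew_mult \<sigma> \<delta> F G + skew_mult \<sigma> \<delta> F H"
  by (simp add: skew_mult_def word_times_add scale_add sum.distrib)

lemma skew_mult_const: "skew_mult \<sigma> \<delta> (const c) F = scale c F"
  by (simp add: skew_mult_single)

lemma skew_mult_one_left: "skew_mult \<sigma> \<delta> (const 1) F = F"
  by (simp add: skew_mult_single)

lemma skew_mult_one_right: "skew_mult \<sigma> \<delta> F (const 1) = F"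
  by (induction F rule: skew_poly_induct)
     (simp_all add: skew_mult_single word_times_word scale_single skew_mult_add_left)

lemma skew_mult_words:
  "skew_mult \<sigma> \<delta> (Poly_Mapping.single m 1) (Poly_Mapping.single m' 1) =
     Poly_Mapping.single (m @ m') 1"
  by (simp add: skew_mult_single word_times_word)

lemma skew_mult_var_const:
  "skew_mult \<sigma> \<delta> (var i) (const c) =
     (\<Sum>j\<in>UNIV. skew_mult \<sigma> \<delta> (const (\<sigma> c $ i $ j)) (var j)) + const (\<delta> c $ i)"
  by (simp add: skew_mult_single var_times_single scale_single)

lemma skew_mult_scale: "skew_mult \<sigma> \<delta> (scale c F) G = scale c (skew_mult \<sigma> \<delta> F G)"
  by (induction F rule: skew_poly_induct)
     (simp_all add: scale_single skew_mult_single scale_scale scale_add skew_mult_add_left)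

lemma skew_mult_var_times:
  "skew_mult \<sigma> \<delta> (var_times \<sigma> \<delta> i F) G = var_times \<sigma> \<delta> i (skew_mult \<sigma> \<delta> F G)"
  by (induction F rule: skew_poly_induct)
     (simp_all add: var_times_single skew_mult_single skew_mult_add_left skew_mult_sum_left
        var_times_scale var_times_add)

lemma skew_mult_word_times:
  "skew_mult \<sigma> \<delta> (word_times \<sigma> \<delta> m F) G = word_times \<sigma> \<delta> m (skew_mult \<sigma> \<delta> F G)"
  by (induction m) (simp_all add: skew_mult_var_times)

lemma skew_mult_assoc:
  "skew_mult \<sigma> \<delta> (skew_mult \<sigma> \<delta> F G) H = skew_mult \<sigma> \<delta> F (skew_mult \<sigma> \<delta> G H)"
  by (induction F rule: skew_poly_induct)
     (simp_all add: skew_mult_single skew_mult_add_left skew_mult_scale skew_mult_word_times)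

end

text \<open>
  A pair \<open>(Q, c)\<close> consists of the quotients \<open>Q i\<close> and the remainder \<open>c\<close>. The right decomposition
  exists uniquely for all \<open>\<sigma>\<close>, \<open>\<delta>\<close>; the left one does when \<open>phi \<sigma>\<close> is bijective, and
  \<open>Delta_L_var\<close>, \<open>Delta_L\<close> are meaningful only in that case.
\<close>

definition right_decomp ::
    "('a::division_ring \<Rightarrow> 'a^'n^'n) \<Rightarrow> ('a \<Rightarrow> 'a^'n) \<Rightarrow> 'a^'n \<Rightarrow> ('a, 'n::finite) skew_poly \<Rightarrow>
     ('n \<Rightarrow> ('a, 'n) skew_poly) \<times> 'a \<Rightarrow> bool" where
  "right_decomp \<sigma> \<delta> a F = (\<lambda>(Q, c).
     F = (\<Sum>i\<in>UNIV. skew_mult \<sigma> \<delta> (Q i) (var i - const (a $ i))) + const c)"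

definition left_decomp ::
    "('a::division_ring \<Rightarrow> 'a^'n^'n) \<Rightarrow> ('a \<Rightarrow> 'a^'n) \<Rightarrow> 'a^'n \<Rightarrow> ('a, 'n::finite) skew_poly \<Rightarrow>
     ('n \<Rightarrow> ('a, 'n) skew_poly) \<times> 'a \<Rightarrow> bool" where
  "left_decomp \<sigma> \<delta> a F = (\<lambda>(Q, c).
     F = (\<Sum>i\<in>UNIV. skew_mult \<sigma> \<delta> (var i - const (a $ i)) (Q i)) + const c)"

definition Delta_var ::
    "('a::division_ring \<Rightarrow> 'a^'n^'n) \<Rightarrow> ('a \<Rightarrow> 'a^'n) \<Rightarrow> 'a^'n \<Rightarrow> 'n::finite \<Rightarrow>
     ('a, 'n) skew_poly \<Rightarrow> ('a, 'n) skew_poly" where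
  "Delta_var \<sigma> \<delta> a i F = fst (THE Qc. right_decomp \<sigma> \<delta> a F Qc) i"

definition Delta_L_var ::
    "('a::division_ring \<Rightarrow> 'a^'n^'n) \<Rightarrow> ('a \<Rightarrow> 'a^'n) \<Rightarrow> 'a^'n \<Rightarrow> 'n::finite \<Rightarrow>
     ('a, 'n) skew_poly \<Rightarrow> ('a, 'n) skew_poly" where
  "Delta_L_var \<sigma> \<delta> a i F = fst (THE Qc. left_decomp \<sigma> \<delta> a F Qc) i"

text \<open>
  For \<open>m = [i\<^sub>1, \<dots>, i\<^sub>s]\<close> the operator for \<open>i\<^sub>s\<close> is applied first in \<open>Delta\<close>, and the
  one for \<open>i\<^sub>1\<close> is applied first in \<open>Delta_L\<close>.
\<close>

definition Delta ::
    "('a::division_ring \<Rightarrow> 'a^'n^'n) \<Rightarrow> ('a \<Rightarrow> 'a^'n) \<Rightarrow> 'a^'n \<Rightarrow> ('n::finite) list \<Rightarrow>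
     ('a, 'n) skew_poly \<Rightarrow> ('a, 'n) skew_poly" where
  "Delta \<sigma> \<delta> a m F = foldr (Delta_var \<sigma> \<delta> a) m F"

definition Delta_L ::
    "('a::division_ring \<Rightarrow> 'a^'n^'n) \<Rightarrow> ('a \<Rightarrow> 'a^'n) \<Rightarrow> 'a^'n \<Rightarrow> ('n::finite) list \<Rightarrow>
     ('a, 'n) skew_poly \<Rightarrow> ('a, 'n) skew_poly" where
  "Delta_L \<sigma> \<delta> a m F = fold (Delta_L_var \<sigma> \<delta> a) m F"

end

theory Submission
  imports Defs
begin

text \<open>
  Each operator \<open>\<Delta>\<^sup>m\<close> is a composite of one-variable operators, so everything reduces to one
  variable. There the decomposition \<open>F = \<Sum>\<^sub>i Q\<^sub>i (x\<^sub>i - a\<^sub>i) + c\<close> is visibly compatible with the left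
  linear structure: multiplying a decomposition of \<open>F\<close> by \<open>\<lambda>\<close> and adding one of \<open>G\<close> gives a
  decomposition of \<open>\<lambda> F + G\<close> (\<open>right_decomp_linear\<close>), and a constant is its own remainder with zero
  quotients. Quotients being unique, they depend linearly on \<open>F\<close>. The left-hand version is the mirror
  image, with scalars acting from the right.

  The quotients are specified by a definite description, so the content of the proof is that the
  decompositions exist and are unique.

  \<^item> Existence on the right: the decomposable elements form a left submodule that contains \<open>1\<close> and is
  stable under left multiplication by each \<open>x\<^sub>i\<close>, because \<open>x\<^sub>i c\<close> is a linear polynomial; hence they
  contain all words.

  \<^item> Existence on the left: scalars must be moved to the right of a variable. Surjectivity of
  \<^term>\<open>phi \<sigma>\<close> says precisely that every \<open>c x\<^sub>i\<close> is \<open>\<Sum>\<^sub>j x\<^sub>j g\<^sub>j\<close> up to a constant, which allows an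
  induction on words that splits off the first letter.

  \<^item> Uniqueness: let a combination of the \<open>x\<^sub>i - a\<^sub>i\<close> with coefficients \<open>Q\<^sub>i\<close> be constant, and look at
  the words of greatest length in the \<open>Q\<^sub>i\<close>. One degree higher only the products with the \<open>x\<^sub>i\<close>
  contribute. On the right the products \<open>Q\<^sub>i x\<^sub>i\<close> have disjoint supports; on the left the coefficients
  of each longest word form a vector that \<^term>\<open>phi \<sigma>\<close> kills, and injectivity applies. So the leading
  coefficients vanish, and descending in the length (\<open>vanish_by_descending_length\<close>) all
  coefficients do.
\<close>

section \<open>Coefficients of products\<close>

text \<open>
  To show that a family of skew polynomials is zero it suffices to treat its leading coefficients,
  since only finitely many words occur in a finite family.
\<close>

lemma vanish_by_descending_length:
  fixes Q :: "'n::finite \<Rightarrow> ('a::division_ring, 'n) skew_poly"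
  assumes lead: "\<And>w i. (\<And>j v. length v > length w \<Longrightarrow> Poly_Mapping.lookup (Q j) v = 0) \<Longrightarrow>
                   Poly_Mapping.lookup (Q i) w = 0"
  shows "Q = (\<lambda>_. 0)"
proof -
  define K where "K = (\<Union>i. Poly_Mapping.keys (Q i))"
  define N where "N = Max (insert 0 (length ` K))"
  have "finite K"
    by (simp add: K_def)
  have bound: "length w \<le> N" if "Poly_Mapping.lookup (Q i) w \<noteq> 0" for i w
  proof -
    have "w \<in> K"
      using that by (auto simp: K_def in_keys_iff)
    with \<open>finite K\<close> show ?thesis
      by (simp add: N_def)
  qed
  have "Poly_Mapping.lookup (Q i) w = 0" for i w
  proof (induction "Suc N - length w" arbitrary: i w rule: less_induct)
    case less
    show ?case
    proof (cases "length w \<le> N")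
      case True
      show ?thesis
      proof (rule lead)
        fix j and v :: "'n list"
        assume "length v > length w"
        with True have "Suc N - length v < Suc N - length w"
          by linarith
        thus "Poly_Mapping.lookup (Q j) v = 0"
          by (rule less)
      qed
    qed (use bound in blast)
  qed
  thus ?thesis
    by (intro ext poly_mapping_eqI) simp
qed

context
  fixes \<sigma> :: "'a::division_ring \<Rightarrow> 'a^'n::finite^'n" and \<delta> :: "'a \<Rightarrow> 'a^'n"
  assumes \<sigma>: "matrix_ring_hom \<sigma>" and \<delta>: "vector_derivation \<sigma> \<delta>"
begin

abbreviation (input) skew_times (infixl "\<star>" 70) where
  "F \<star> G \<equiv> skew_mult \<sigma> \<delta> F G"

lemmas sig = sigma_simps[OF \<sigma> \<delta>] delta_simps[OF \<sigma> \<delta>]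
lemmas mult_single = skew_mult_single[OF \<sigma> \<delta>]
lemmas mult_const = skew_mult_const[OF \<sigma> \<delta>]
lemmas mult_add_left = skew_mult_add_left[OF \<sigma> \<delta>]
lemmas mult_add_right = skew_mult_add_right[OF \<sigma> \<delta>]
lemmas mult_assoc = skew_mult_assoc[OF \<sigma> \<delta>]
lemmas mult_sum_left = skew_mult_sum_left[OF \<sigma> \<delta>]
lemmas mult_zero_left = skew_mult_zero[OF \<sigma> \<delta>]
lemmas mult_one_right = skew_mult_one_right[OF \<sigma> \<delta>]
lemmas word_simps = word_times_simps[OF \<sigma> \<delta>]

lemma mult_zero_right: "F \<star> 0 = 0"
  using mult_add_right[of F 0 0] by simp

lemma mult_sum_right: "F \<star> sum f A = (\<Sum>x\<in>A. F \<star> f x)"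
  by (induction A rule: infinite_finite_induct) (simp_all add: mult_zero_right mult_add_right)

lemma mult_diff_left: "(F - G) \<star> H = F \<star> H - G \<star> H"
  using mult_add_left[of "F - G" G H] by (simp add: algebra_simps)

lemma mult_diff_right: "F \<star> (G - H) = F \<star> G - F \<star> H"
  using mult_add_right[of F "G - H" H] by (simp add: algebra_simps)

lemma const_mult_const: "const c \<star> const d = const (c * d)"
  by (simp add: mult_const scale_single)

lemma minus_one_mult: "const (- 1) \<star> F = - F"
  by (rule poly_mapping_eqI) (simp add: mult_const lookup_scale)

lemma mult_minus_one: "F \<star> const (- 1) = - F"
proof -
  have "F \<star> const (- 1) + F \<star> const 1 = F \<star> (const (- 1) + const 1)"
    by (rule mult_add_right[symmetric])
  also have "const (- 1) + const 1 = (0 :: ('a, 'n) skew_poly)"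
    by (simp add: single_add[symmetric])
  finally show ?thesis
    by (simp add: mult_zero_right mult_one_right eq_neg_iff_add_eq_0)
qed

lemma lookup_var_times:
  "Poly_Mapping.lookup (var_times \<sigma> \<delta> i F) (k # w) =
     \<sigma> (Poly_Mapping.lookup F w) $ i $ k + \<delta> (Poly_Mapping.lookup F (k # w)) $ i"
proof (induction F rule: skew_poly_induct)
  case zero
  show ?case
    by (simp add: sig var_times_zero[OF \<sigma> \<delta>])
next
  case (single m c)
  have "(\<Sum>j\<in>UNIV. if j = k \<and> m = w then \<sigma> c $ i $ j else 0) =
        (\<Sum>j\<in>UNIV. if j = k then if m = w then \<sigma> c $ i $ k else 0 else 0)"
    by (rule sum.cong) auto
  thus ?case
    by (simp add: var_times_single[OF \<sigma> \<delta>] lookup_add lookup_sum lookup_single when_def sig)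
next
  case (add F G)
  thus ?case
    by (simp add: var_times_add[OF \<sigma> \<delta>] lookup_add sig)
qed

lemma lookup_mult_var:
  "Poly_Mapping.lookup (F \<star> var j) (w @ [k]) = (if j = k then Poly_Mapping.lookup F w else 0)"
proof (induction F rule: skew_poly_induct)
  case (single m c)
  have "Poly_Mapping.single m c \<star> var j = Poly_Mapping.single (m @ [j]) c"
    by (simp add: mult_single word_times_word[OF \<sigma> \<delta>] scale_single)
  thus ?case
    by (simp add: lookup_single when_def)
qed (simp_all add: mult_zero_left mult_add_left lookup_add)

lemma lookup_word_times_const:
  "length w > length m \<Longrightarrow> Poly_Mapping.lookup (word_times \<sigma> \<delta> m (const b)) w = 0"
proof (induction m arbitrary: w)
  case Nil
  thus ?case
    by (auto simp: word_simps lookup_single when_def)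
next
  case (Cons i m)
  from Cons.prems obtain k v where "w = k # v"
    by (cases w) auto
  thus ?case
    using Cons by (simp add: word_simps lookup_var_times sig)
qed

text \<open>
  Moving a constant to the left past a word produces only words that are at most as long; hence the
  terms \<open>Q\<^sub>i a\<^sub>i\<close> cannot interfere with the leading part of \<open>Q\<^sub>i x\<^sub>i\<close>.
\<close>

lemma lookup_mult_const:
  assumes "\<And>v. length v \<ge> length w \<Longrightarrow> Poly_Mapping.lookup F v = 0"
  shows "Poly_Mapping.lookup (F \<star> const b) w = 0"
proof -
  have "length m < length w" if "m \<in> Poly_Mapping.keys F" for m
    using that assms[of m] by (auto simp: in_keys_iff not_le[symmetric])
  thus ?thesis
    by (simp add: skew_mult_def lookup_sum lookup_scale lookup_word_times_const)
qed

section \<open>Division on the right\<close>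

lemma right_decomp_const: "right_decomp \<sigma> \<delta> a (const c) (\<lambda>_. 0, c)"
  by (simp add: right_decomp_def mult_zero_left)

lemma right_decomp_linear:
  assumes "right_decomp \<sigma> \<delta> a F (Q, c)" "right_decomp \<sigma> \<delta> a G (P, d)"
  shows "right_decomp \<sigma> \<delta> a (const l \<star> F + G) (\<lambda>i. const l \<star> Q i + P i, l * c + d)"
proof -
  let ?y = "\<lambda>i. var i - const (a $ i)"
  have F: "F = (\<Sum>i\<in>UNIV. Q i \<star> ?y i) + const c" and G: "G = (\<Sum>i\<in>UNIV. P i \<star> ?y i) + const d"
    using assms by (simp_all add: right_decomp_def)
  have "const l \<star> F + G = (\<Sum>i\<in>UNIV. (const l \<star> Q i + P i) \<star> ?y i) + const (l * c + d)"
    by (subst F, subst G) (simp add: mult_add_left mult_add_right mult_sum_right mult_assoc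
        const_mult_const sum.distrib single_add)
  thus ?thesis
    by (simp add: right_decomp_def)
qed

text \<open>
  In \<open>x\<^sub>i F\<close> the quotients of \<open>F\<close> are just multiplied by \<open>x\<^sub>i\<close>, and the remainder \<open>c\<close> contributes
  \<open>x\<^sub>i c = \<Sum>\<^sub>j \<sigma>\<^sub>i\<^sub>j(c) x\<^sub>j + \<delta>\<^sub>i(c)\<close>, which only needs constants added to its variables.
\<close>

lemma right_decomp_var_mult:
  assumes "right_decomp \<sigma> \<delta> a F (Q, c)"
  shows "right_decomp \<sigma> \<delta> a (var i \<star> F)
           (\<lambda>j. var i \<star> Q j + const (\<sigma> c $ i $ j), (\<Sum>j\<in>UNIV. \<sigma> c $ i $ j * a $ j) + \<delta> c $ i)"
proof -
  let ?y = "\<lambda>i. var i - const (a $ i)"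
  have F: "F = (\<Sum>j\<in>UNIV. Q j \<star> ?y j) + const c"
    using assms by (simp add: right_decomp_def)
  have "(\<Sum>j\<in>UNIV. const (\<sigma> c $ i $ j) \<star> var j) =
        (\<Sum>j\<in>UNIV. const (\<sigma> c $ i $ j) \<star> ?y j) + const (\<Sum>j\<in>UNIV. \<sigma> c $ i $ j * a $ j)"
    by (simp add: mult_diff_right const_mult_const sum_subtractf single_sum)
  hence "var i \<star> const c = (\<Sum>j\<in>UNIV. const (\<sigma> c $ i $ j) \<star> ?y j) +
      const ((\<Sum>j\<in>UNIV. \<sigma> c $ i $ j * a $ j) + \<delta> c $ i)"
    by (simp add: skew_mult_var_const[OF \<sigma> \<delta>] single_add add.assoc)
  moreover have "var i \<star> F = (\<Sum>j\<in>UNIV. var i \<star> Q j \<star> ?y j) + var i \<star> const c"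
    by (subst F) (simp add: mult_add_right mult_sum_right mult_assoc)
  ultimately show ?thesis
    by (simp add: right_decomp_def mult_add_left sum.distrib add.assoc)
qed

lemma right_decomp_exists: "\<exists>Q c. right_decomp \<sigma> \<delta> a F (Q, c)"
proof -
  have zero: "right_decomp \<sigma> \<delta> a 0 (\<lambda>_. 0, 0)"
    using right_decomp_const[of a 0] by simp
  have word: "\<exists>Q c. right_decomp \<sigma> \<delta> a (Poly_Mapping.single m 1) (Q, c)" for m
  proof (induction m)
    case Nil
    show ?case
      using right_decomp_const by blast
  next
    case (Cons i m)
    have "Poly_Mapping.single (i # m) 1 = var i \<star> Poly_Mapping.single m 1"
      by (simp add: skew_mult_words[OF \<sigma> \<delta>])
    thus ?case
      using Cons right_decomp_var_mult by fastforce
  qed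
  show ?thesis
  proof (induction F rule: skew_poly_induct)
    case zero
    show ?case
      using right_decomp_const[of a 0] by auto
  next
    case (single m c)
    have "Poly_Mapping.single m c = const c \<star> Poly_Mapping.single m 1 + 0"
      by (simp add: mult_const scale_single)
    moreover obtain Q d where "right_decomp \<sigma> \<delta> a (Poly_Mapping.single m 1) (Q, d)"
      using word by blast
    ultimately show ?case
      using right_decomp_linear[OF _ zero, of "Poly_Mapping.single m 1" Q d c] by auto
  next
    case (add F G)
    then obtain Q c P d where "right_decomp \<sigma> \<delta> a F (Q, c)" "right_decomp \<sigma> \<delta> a G (P, d)"
      by blast
    hence "right_decomp \<sigma> \<delta> a (const 1 \<star> F + G) (\<lambda>i. const 1 \<star> Q i + P i, 1 * c + d)"
      by (rule right_decomp_linear)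
    thus ?case
      by (auto simp: mult_const)
  qed
qed

lemma right_decomp_zero:
  assumes "right_decomp \<sigma> \<delta> a 0 (Q, c)"
  shows "Q = (\<lambda>_. 0)"
proof (rule vanish_by_descending_length)
  fix w :: "'n list" and k
  assume top: "\<And>j v. length v > length w \<Longrightarrow> Poly_Mapping.lookup (Q j) v = 0"
  have lower: "Poly_Mapping.lookup (Q i \<star> const b) (w @ [k]) = 0" for i b
    by (rule lookup_mult_const) (simp add: top)
  have "0 = Poly_Mapping.lookup
              ((\<Sum>i\<in>UNIV. Q i \<star> var i - Q i \<star> const (a $ i)) + const c) (w @ [k])"
    using assms by (simp add: right_decomp_def mult_diff_right)
  also have "\<dots> = (\<Sum>i\<in>UNIV. if i = k then Poly_Mapping.lookup (Q i) w else 0)"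
    by (simp add: lookup_add lookup_sum lookup_minus lookup_mult_var lower lookup_single when_def)
  finally show "Poly_Mapping.lookup (Q k) w = 0"
    by simp
qed

lemma right_decomp_unique:
  assumes "right_decomp \<sigma> \<delta> a F (Q, c)" "right_decomp \<sigma> \<delta> a F (P, d)"
  shows "Q = P \<and> c = d"
proof -
  \<comment> \<open>The scalar \<open>-1\<close> turns the two decompositions into one of \<open>- F + F\<close>.\<close>
  have "right_decomp \<sigma> \<delta> a 0 (\<lambda>i. - Q i + P i, - c + d)"
    using right_decomp_linear[OF assms, of "- 1"] by (simp add: minus_one_mult)
  hence "(\<lambda>i. - Q i + P i) = (\<lambda>_. 0)"
    by (rule right_decomp_zero)
  hence "Q = P"
    by (simp add: fun_eq_iff neg_eq_iff_add_eq_0[symmetric])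
  moreover from this have "const c = (const d :: ('a, 'n) skew_poly)"
    using assms by (auto simp: right_decomp_def)
  ultimately show ?thesis
    by (metis lookup_single_eq)
qed

lemma Delta_var_eq:
  assumes "right_decomp \<sigma> \<delta> a F (Q, c)"
  shows "Delta_var \<sigma> \<delta> a i F = Q i"
proof -
  have "(THE Qc. right_decomp \<sigma> \<delta> a F Qc) = (Q, c)"
    using assms right_decomp_unique by (intro the_equality) auto
  thus ?thesis
    by (simp add: Delta_var_def)
qed

lemma Delta_var_const: "Delta_var \<sigma> \<delta> a i (const c) = 0"
  by (rule Delta_var_eq[OF right_decomp_const])

lemma Delta_var_linear:
  "Delta_var \<sigma> \<delta> a i (const l \<star> F + G) =
     const l \<star> Delta_var \<sigma> \<delta> a i F + Delta_var \<sigma> \<delta> a i G"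
proof -
  obtain Q c P d where "right_decomp \<sigma> \<delta> a F (Q, c)" "right_decomp \<sigma> \<delta> a G (P, d)"
    using right_decomp_exists[of a F] right_decomp_exists[of a G] by blast
  thus ?thesis
    using right_decomp_linear[of a F Q c G P d l] by (simp add: Delta_var_eq)
qed

lemma Delta_linear:
  "Delta \<sigma> \<delta> a m (const l \<star> F + G) = const l \<star> Delta \<sigma> \<delta> a m F + Delta \<sigma> \<delta> a m G"
  by (induction m) (simp_all add: Delta_def Delta_var_linear)

lemma Delta_const: "m \<noteq> [] \<Longrightarrow> Delta \<sigma> \<delta> a m (const c) = 0"
proof (induction m)
  case (Cons i m)
  have "Delta_var \<sigma> \<delta> a i 0 = 0"
    using Delta_var_const[of a i 0] by simp
  with Cons show ?case
    by (cases m) (simp_all add: Delta_def Delta_var_const)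
qed simp

section \<open>Division on the left\<close>

lemma left_decomp_const: "left_decomp \<sigma> \<delta> a (const c) (\<lambda>_. 0, c)"
  by (simp add: left_decomp_def mult_zero_right)

lemma left_decomp_linear:
  assumes "left_decomp \<sigma> \<delta> a F (Q, c)" "left_decomp \<sigma> \<delta> a G (P, d)"
  shows "left_decomp \<sigma> \<delta> a (F \<star> const l + G) (\<lambda>i. Q i \<star> const l + P i, c * l + d)"
proof -
  let ?y = "\<lambda>i. var i - const (a $ i)"
  have F: "F = (\<Sum>i\<in>UNIV. ?y i \<star> Q i) + const c" and G: "G = (\<Sum>i\<in>UNIV. ?y i \<star> P i) + const d"
    using assms by (simp_all add: left_decomp_def)
  have "F \<star> const l + G = (\<Sum>i\<in>UNIV. ?y i \<star> (Q i \<star> const l + P i)) + const (c * l + d)"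
    by (subst F, subst G) (simp add: mult_add_left mult_add_right mult_sum_left mult_assoc
        const_mult_const sum.distrib single_add)
  thus ?thesis
    by (simp add: left_decomp_def)
qed

lemma left_decomp_add:
  assumes "left_decomp \<sigma> \<delta> a F (Q, c)" "left_decomp \<sigma> \<delta> a G (P, d)"
  shows "left_decomp \<sigma> \<delta> a (F + G) (\<lambda>i. Q i + P i, c + d)"
  using left_decomp_linear[OF assms, of 1] by (simp add: mult_one_right)

text \<open>
  A preimage \<open>g\<close> of \<open>c e\<^sub>i\<close> under \<^term>\<open>phi \<sigma>\<close> makes the linear part of \<open>\<Sum>\<^sub>j x\<^sub>j g\<^sub>j\<close> equal to \<open>c x\<^sub>i\<close>.
\<close>

lemma const_mult_var_left:
  assumes "surj (phi \<sigma>)"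
  obtains g e where "const c \<star> var i = (\<Sum>j\<in>UNIV. (var j - const (a $ j)) \<star> const (g j)) + const e"
proof -
  obtain g where g: "phi \<sigma> g = (\<chi> k. if k = i then c else 0)"
    using assms by (metis surjD)
  have coeff: "(\<Sum>j\<in>UNIV. \<sigma> (g $ j) $ j $ k) = (if k = i then c else 0)" for k
    using arg_cong[OF g, of "\<lambda>v. v $ k"] by (simp add: phi_def)
  have "(\<Sum>j\<in>UNIV. var j \<star> const (g $ j)) =
        (\<Sum>k\<in>UNIV. \<Sum>j\<in>UNIV. const (\<sigma> (g $ j) $ j $ k) \<star> var k) +
        const (\<Sum>j\<in>UNIV. \<delta> (g $ j) $ j)"
    by (subst sum.swap) (simp add: skew_mult_var_const[OF \<sigma> \<delta>] sum.distrib single_sum)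
  also have "(\<Sum>k\<in>UNIV. \<Sum>j\<in>UNIV. const (\<sigma> (g $ j) $ j $ k) \<star> var k) =
             (\<Sum>k\<in>UNIV. const (\<Sum>j\<in>UNIV. \<sigma> (g $ j) $ j $ k) \<star> var k)"
    by (simp add: mult_sum_left single_sum)
  also have "\<dots> = (\<Sum>k\<in>UNIV. if k = i then const c \<star> var k else 0)"
    by (intro sum.cong refl) (simp add: coeff mult_zero_left)
  finally have "const c \<star> var i =
      (\<Sum>j\<in>UNIV. var j \<star> const (g $ j)) - const (\<Sum>j\<in>UNIV. \<delta> (g $ j) $ j)"
    by simp
  also have "(\<Sum>j\<in>UNIV. var j \<star> const (g $ j)) =
      (\<Sum>j\<in>UNIV. (var j - const (a $ j)) \<star> const (g $ j)) + const (\<Sum>j\<in>UNIV. a $ j * g $ j)"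
    by (simp add: mult_diff_left const_mult_const sum_subtractf single_sum)
  finally have "const c \<star> var i = (\<Sum>j\<in>UNIV. (var j - const (a $ j)) \<star> const (g $ j)) +
      const ((\<Sum>j\<in>UNIV. a $ j * g $ j) - (\<Sum>j\<in>UNIV. \<delta> (g $ j) $ j))"
    by (simp add: single_diff algebra_simps)
  thus ?thesis
    by (rule that)
qed

lemma left_decomp_exists:
  assumes "surj (phi \<sigma>)"
  shows "\<exists>Q c. left_decomp \<sigma> \<delta> a F (Q, c)"
proof -
  have monom: "\<exists>Q d. left_decomp \<sigma> \<delta> a (Poly_Mapping.single m c) (Q, d)" for m c
  proof (induction m arbitrary: c)
    case Nil
    show ?case
      using left_decomp_const by blast
  next
    case (Cons i m)
    obtain g e where ge:
      "const c \<star> var i = (\<Sum>j\<in>UNIV. (var j - const (a $ j)) \<star> const (g j)) + const e"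
      using const_mult_var_left[OF assms] .
    let ?P = "\<lambda>j. const (g j) \<star> Poly_Mapping.single m 1"
    have "Poly_Mapping.single (i # m) c = const c \<star> var i \<star> Poly_Mapping.single m 1"
      by (simp only: mult_assoc skew_mult_words[OF \<sigma> \<delta>])
        (simp add: mult_const scale_single)
    also have "\<dots> = (\<Sum>j\<in>UNIV. (var j - const (a $ j)) \<star> ?P j) + Poly_Mapping.single m e"
      unfolding ge by (simp add: mult_add_left mult_sum_left mult_assoc mult_const scale_single)
    finally have split: "Poly_Mapping.single (i # m) c = \<dots>" .
    have "left_decomp \<sigma> \<delta> a (\<Sum>j\<in>UNIV. (var j - const (a $ j)) \<star> ?P j) (?P, 0)"
      by (simp add: left_decomp_def)
    thus ?case
      unfolding split using Cons[of e] left_decomp_add by blast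
  qed
  show ?thesis
  proof (induction F rule: skew_poly_induct)
    case zero
    show ?case
      using left_decomp_const[of a 0] by auto
  next
    case (single m c)
    show ?case
      by (rule monom)
  next
    case (add F G)
    thus ?case
      using left_decomp_add by blast
  qed
qed

lemma left_decomp_zero:
  assumes inj: "inj (phi \<sigma>)" and "left_decomp \<sigma> \<delta> a 0 (Q, c)"
  shows "Q = (\<lambda>_. 0)"
proof (rule vanish_by_descending_length)
  fix w :: "'n list" and i
  assume top: "\<And>j v. length v > length w \<Longrightarrow> Poly_Mapping.lookup (Q j) v = 0"
  let ?g = "\<chi> i. Poly_Mapping.lookup (Q i) w"
  have "phi \<sigma> ?g $ k = 0" for k
  proof -
    have "0 = Poly_Mapping.lookup
                ((\<Sum>i\<in>UNIV. var_times \<sigma> \<delta> i (Q i) - scale (a $ i) (Q i)) + const c) (k # w)"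
      using assms by (simp add: left_decomp_def mult_diff_left mult_single word_simps)
    also have "\<dots> = (\<Sum>i\<in>UNIV. \<sigma> (Poly_Mapping.lookup (Q i) w) $ i $ k)"
      by (simp add: lookup_add lookup_sum lookup_minus lookup_var_times lookup_scale top
          lookup_single when_def sig)
    finally show ?thesis
      by (simp add: phi_def)
  qed
  hence "phi \<sigma> ?g = phi \<sigma> 0"
    by (simp add: vec_eq_iff) (simp add: phi_def sig)
  hence "?g = 0"
    by (rule injD[OF inj])
  thus "Poly_Mapping.lookup (Q i) w = 0"
    by (simp add: vec_eq_iff)
qed

lemma left_decomp_unique:
  assumes "inj (phi \<sigma>)" "left_decomp \<sigma> \<delta> a F (Q, c)" "left_decomp \<sigma> \<delta> a F (P, d)"
  shows "Q = P \<and> c = d"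
proof -
  \<comment> \<open>The scalar \<open>-1\<close> turns the two decompositions into one of \<open>- F + F\<close>.\<close>
  have "left_decomp \<sigma> \<delta> a 0 (\<lambda>i. - Q i + P i, - c + d)"
    using left_decomp_linear[OF assms(2,3), of "- 1"] by (simp add: mult_minus_one)
  hence "(\<lambda>i. - Q i + P i) = (\<lambda>_. 0)"
    by (rule left_decomp_zero[OF assms(1)])
  hence "Q = P"
    by (simp add: fun_eq_iff neg_eq_iff_add_eq_0[symmetric])
  moreover from this have "const c = (const d :: ('a, 'n) skew_poly)"
    using assms by (auto simp: left_decomp_def)
  ultimately show ?thesis
    by (metis lookup_single_eq)
qed

lemma Delta_L_var_eq:
  assumes "inj (phi \<sigma>)" "left_decomp \<sigma> \<delta> a F (Q, c)"
  shows "Delta_L_var \<sigma> \<delta> a i F = Q i"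
proof -
  have "(THE Qc. left_decomp \<sigma> \<delta> a F Qc) = (Q, c)"
    using assms left_decomp_unique by (intro the_equality) auto
  thus ?thesis
    by (simp add: Delta_L_var_def)
qed

lemma Delta_L_var_const:
  assumes "inj (phi \<sigma>)"
  shows "Delta_L_var \<sigma> \<delta> a i (const c) = 0"
  by (rule Delta_L_var_eq[OF assms left_decomp_const])

lemma Delta_L_var_linear:
  assumes "bij (phi \<sigma>)"
  shows "Delta_L_var \<sigma> \<delta> a i (F \<star> const l + G) =
           Delta_L_var \<sigma> \<delta> a i F \<star> const l + Delta_L_var \<sigma> \<delta> a i G"
proof -
  obtain Q c P d where "left_decomp \<sigma> \<delta> a F (Q, c)" "left_decomp \<sigma> \<delta> a G (P, d)"
    using left_decomp_exists[OF bij_is_surj[OF assms], of a F]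
      left_decomp_exists[OF bij_is_surj[OF assms], of a G] by blast
  thus ?thesis
    using left_decomp_linear[of a F Q c G P d l]
    by (simp add: Delta_L_var_eq[OF bij_is_inj[OF assms]])
qed

lemma Delta_L_linear:
  assumes "bij (phi \<sigma>)"
  shows "Delta_L \<sigma> \<delta> a m (F \<star> const l + G) =
           Delta_L \<sigma> \<delta> a m F \<star> const l + Delta_L \<sigma> \<delta> a m G"
  by (induction m arbitrary: F G) (simp_all add: Delta_L_def Delta_L_var_linear[OF assms])

lemma Delta_L_const:
  assumes "inj (phi \<sigma>)"
  shows "m \<noteq> [] \<Longrightarrow> Delta_L \<sigma> \<delta> a m (const c) = 0"
proof (induction m rule: rev_induct)
  case (snoc i m)
  have "Delta_L_var \<sigma> \<delta> a i 0 = 0"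
    using Delta_L_var_const[OF assms, of a i 0] by simp
  with snoc show ?case
    by (cases m) (simp_all add: Delta_L_def Delta_L_var_const[OF assms])
qed simp

end

section \<open>Linearity of the iterated quotients\<close>

theorem lemma2p5:
  fixes \<sigma> :: "'a::division_ring \<Rightarrow> 'a^'n::finite^'n"
    and \<delta> :: "'a \<Rightarrow> 'a^'n"
    and F G :: "('a, 'n) skew_poly"
    and a :: "'a^'n"
    and l :: 'a
    and m :: "'n list"
  assumes "matrix_ring_hom \<sigma>"
    and "vector_derivation \<sigma> \<delta>"
  shows "((m \<noteq> [] \<longrightarrow> Delta \<sigma> \<delta> a m (const l) = 0) \<and>
          Delta \<sigma> \<delta> a m (skew_mult \<sigma> \<delta> (const l) F + G) =
            skew_mult \<sigma> \<delta> (const l) (Delta \<sigma> \<delta> a m F) + Delta \<sigma> \<delta> a m G) \<and>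
         (Modules.additive (phi \<sigma>) \<and> bij (phi \<sigma>) \<longrightarrow>
          (m \<noteq> [] \<longrightarrow> Delta_L \<sigma> \<delta> a m (const l) = 0) \<and>
          Delta_L \<sigma> \<delta> a m (skew_mult \<sigma> \<delta> F (const l) + G) =
            skew_mult \<sigma> \<delta> (Delta_L \<sigma> \<delta> a m F) (const l) + Delta_L \<sigma> \<delta> a m G)"
proof (intro conjI impI; (elim conjE)?)
  assume "bij (phi \<sigma>)" and "m \<noteq> []"
  thus "Delta_L \<sigma> \<delta> a m (const l) = 0"
    by (intro Delta_L_const[OF assms] bij_is_inj)
qed (simp_all add: Delta_const[OF assms] Delta_linear[OF assms] Delta_L_linear[OF assms])

end
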